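(* Consider the finite memory change-point model with a fixed $\kappa\ge0$, with $\Psi=\Psi_\alpha$ and $\pi_0$ allowed to depend on $\alpha\in(0,1)$, and let $z_0\in[K]^{t_0}$ (with $|z_0|=t_0\ge0$), $\Xi_1\in[K]^{\ell_1}$ and $\Xi_2\in[K]^{\ell_2}$ be an initial sequence and blocks, possibly depending on $\alpha$. Assume that there is a constant $c\in(0,1)$ such that $\sup_{t\ge0,z\in[K]^t}\pi_t(z;\alpha)\le1-c$ for all small enough $\alpha$, and that $\min\{\ell_1,\ell_2\}\ge\kappa$. If $\max\{\ell_1,\ell_2,|z_0|\}=O(1)$ as $\alpha\to0$, then as $\alpha\to0$ $$\max_{i=1,2}d(\Xi_i)=O(1),\quad\max_{i=1,2}M(\Xi_i,\epsilon)=o(|\log\alpha|)\ \text{for any }\epsilon\in(0,1),\quad\max_{i=1,2}\ell_i=O(|\log\alpha|),$$ $$|\log\zeta(\Xi_1)|+\log\widetilde\lambda(\Xi_1)=o(\lambda(z_0,\Xi_1)+|\log\alpha|).$$ In particular, if $z_0=z_0^*$, $\Xi_1=\Xi_1^*$ and $\Xi_2=\Xi_2^*$ are the optimal choices defined in the context, then the lengths of $z_0,\Xi_1$ and $\Xi_2$ are bounded by $K^\kappa$.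
   Context: Fix $2\le K<\infty$ and $[K]=\{1,\dots,K\}$. Finite memory change-point model: $\pi_0\in[0,1)$ is the prior probability that the change has occurred at time $0$; if treatments $x_1,x_2,\dots\in[K]$ are assigned, the conditional probability that the change occurs at time $t\ge1$ given it has not occurred before is $\pi_t(x_1,\dots,x_t)=\Psi(x_t,\mathbb S_{t-1})$, where $\mathbb S_t=\Phi(x_t,\mathbb S_{t-1})$, $\Phi(x,(x_\kappa,\dots,x_1))=(x,x_\kappa,\dots,x_2)$, $\mathbb S_0\in[K]^\kappa$ is a given initial state and $\Psi:[K]\times[K]^\kappa\to[0,1)$. Thus $\pi_t(x_1,\dots,x_t)=\Psi(x_t,x_{t-1},\dots,x_{t-\kappa})$, entries with non-positive index being taken from $\mathbb S_0$. A block of length $\ell$ is $\Xi\in[K]^\ell$, extended cyclically: $\Xi(j\ell+i)=\Xi(i)$ for every integer $j$, $1\le i\le\ell$; $\Xi(i:j)=(\Xi(i),\dots,\Xi(j))$; $|\Xi|=\ell$; $z_0(1:s)$ denotes the first $s$ entries of $z_0$. With $\omega(x)=|\log(1-x)|$: $d(\Xi)$ is the number such that for every $\epsilon>0$ there is a positive integer $M(\Xi,\epsilon)$ (take the smallest such) with $\sup_{t\ge0,z\in[K]^t,j\in[\ell]}|\frac1M\sum_{s=1}^M\omega(\pi_{t+s}(z,\Xi(j:s+j-1)))-d(\Xi)|\le\epsilon$ for all $M\ge M(\Xi,\epsilon)$; for the finite memory model it is $d(\Xi)=\frac1\ell\sum_{j=1}^\ell\omega(\Psi(\Xi(j),\Xi(j-1),\dots,\Xi(j-\kappa)))$.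 $\widetilde\lambda(\Xi)=\sup_{m\ge0,z\in[K]^m}\{1+\sum_{t\ge1}\prod_{s=1}^t(1-\pi_{m+s}(z,\Xi(1:s)))\}$; $\zeta(\Xi)=\inf_{t\ge0,z\in[K]^t,1\le j\le|\Xi|}\max_{1\le s\le2|\Xi|}\pi_{t+s}(z,\Xi(j:j+s-1))$; $$\lambda(z_0,\Xi)=(1-\pi_0)\Big[1+\sum_{t=1}^{t_0}\prod_{s=1}^t(1-\pi_s(z_0(1:s)))+\sum_{t=t_0+1}^\infty\prod_{s=1}^{t_0}(1-\pi_s(z_0(1:s)))\prod_{s=t_0+1}^t(1-\pi_s(z_0,\Xi(1:s-t_0)))\Big].$$ Optimal $z_0^*,\Xi_1^*$. Let $V^*(\mathbb S)=\inf_{(x_1,x_2,\dots)\in[K]^\infty}\sum_{t\ge1}\prod_{s=1}^t(1-\Psi(x_s,\mathbb S_{s-1}))$ with $\mathbb S_0=\mathbb S$, $\mathbb S_t=\Phi(x_t,\mathbb S_{t-1})$; $\upsilon^*(\mathbb S)\in\arg\min_{x\in[K]}(1-\Psi(x,\mathbb S))(1+V^*(\Phi(x,\mathbb S)))$. Starting from the model's initial state $\mathbb S_0^*=\mathbb S_0$, let $x_t^*=\upsilon^*(\mathbb S_{t-1}^* )$, $\mathbb S_t^*=\Phi(x_t^*,\mathbb S_{t-1}^* )$; $u^*=\inf\{t\ge1:\mathbb S_t^*=\mathbb S_\ell^*\text{ for some }0\le\ell<t\}$, $\ell^*\in[0,u^* )$ the integer with $\mathbb S^*_{\ell^*}=\mathbb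 S^*_{u^*}$; $z_0^*=(x_1^*,\dots,x_{\ell^*}^* )$, $\Xi_1^*=(x^*_{\ell^*+1},\dots,x^*_{u^*})$. Optimal $\Xi_2^*$. For each $x\in[K]$ let $I_x=\int\log(g_x/f_x)g_x\,d\mu\in(0,\infty)$ be the Kullback-Leibler divergence between the post-change response density $g_x$ and the pre-change one $f_x$ (with respect to a common $\sigma$-finite measure $\mu$; not depending on $\alpha$). Let $r(x,\mathbb S)=I_x+\omega(\Psi(x,\mathbb S))$, and let $\lambda'\in\mathbb R$, $h':[K]^\kappa\to\mathbb R$ solve $\lambda'+h'(\mathbb S)=\max_{x\in[K]}[r(x,\mathbb S)+h'(\Phi(x,\mathbb S))]$ for all $\mathbb S\in[K]^\kappa$; $\upsilon'(\mathbb S)\in\arg\max_x[r(x,\mathbb S)+h'(\Phi(x,\mathbb S))]$. With $\mathbb S_0'=\mathbb S_0$, $x_t'=\upsilon'(\mathbb S_{t-1}')$, $\mathbb S_t'=\Phi(x_t',\mathbb S_{t-1}')$, let $u'=\inf\{t\ge1:\mathbb S_t'=\mathbb S_\ell'\text{ for some }0\le\ell<t\}$, $\ell'\in[0,u')$ with $\mathbb S'_{\ell'}=\mathbb S'_{u'}$, and $\Xi_2^*=(x'_{\ell'+1},\dots,x'_{u'})$. Asymptotic notation (limits as $\alpha\to0$): $x=o(y)$ if $x/y\to0$; $x=O(y)$ if $\limsup x/y<\infty$. *)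

theory Defs
  imports "HOL-Analysis.Analysis" "HOL-Library.Landau_Symbols"
begin

text \<open>
  Treatments are the numbers \<open>1..K\<close>; a treatment sequence is a list with the earliest treatment
  first, and \<open>lists {1..K}\<close> is the union of all \<open>[K]\<^sup>t\<close>, \<open>t \<ge> 0\<close>. A change-point model is a
  function \<open>p\<close> on treatment sequences: \<open>p []\<close> is the prior \<open>\<pi>\<^sub>0\<close> and \<open>p [x\<^sub>1, \<dots>, x\<^sub>t]\<close> is
  \<open>\<pi>\<^sub>t(x\<^sub>1, \<dots>, x\<^sub>t)\<close>. Infinite sums and logarithms that can be infinite live in \<open>ereal\<close>.
\<close>

subsection \<open>The finite memory model\<close>

definition words :: "nat \<Rightarrow> nat \<Rightarrow> nat list set" where
  "words K n = {xs \<in> lists {1..K}. length xs = n}"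

text \<open>States list the most recent treatment first. For memory length \<open>0\<close> the only state is \<open>[]\<close>,
  and \<open>butlast\<close> is applied after the new treatment is prepended so that it is kept.\<close>

definition Phi :: "nat \<Rightarrow> nat list \<Rightarrow> nat list" where
  "Phi x S = butlast (x # S)"

definition fm_prob :: "(nat \<Rightarrow> nat list \<Rightarrow> real) \<Rightarrow> real \<Rightarrow> nat list \<Rightarrow> nat list \<Rightarrow> real" where
  "fm_prob \<Psi> \<pi>0 S0 z = (if z = [] then \<pi>0 else \<Psi> (last z) (fold Phi (butlast z) S0))"

definition fm_model ::
  "nat \<Rightarrow> nat \<Rightarrow> (nat \<Rightarrow> nat list \<Rightarrow> real) \<Rightarrow> real \<Rightarrow> nat list \<Rightarrow> bool" where
  "fm_model K \<kappa> \<Psi> \<pi>0 S0 \<longleftrightarrow>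
     \<pi>0 \<in> {0..<1} \<and> S0 \<in> words K \<kappa> \<and> (\<forall>x\<in>{1..K}. \<forall>S\<in>words K \<kappa>. \<Psi> x S \<in> {0..<1})"

subsection \<open>Blocks and the quantities attached to them\<close>

definition block_at :: "nat list \<Rightarrow> int \<Rightarrow> nat" where
  "block_at \<Xi> i = \<Xi> ! nat ((i - 1) mod int (length \<Xi>))"

definition block_seg :: "nat list \<Rightarrow> nat \<Rightarrow> nat \<Rightarrow> nat list" where
  "block_seg \<Xi> i j = map (block_at \<Xi>) [int i..int j]"

definition omega :: "real \<Rightarrow> real" where
  "omega x = \<bar>ln (1 - x)\<bar>"

definition sup_dev :: "nat \<Rightarrow> (nat list \<Rightarrow> real) \<Rightarrow> nat list \<Rightarrow> real \<Rightarrow> nat \<Rightarrow> real" where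
  "sup_dev K p \<Xi> \<delta> M =
     (SUP (z, j) \<in> lists {1..K} \<times> {1..length \<Xi>}.
        \<bar>(1 / real M) * (\<Sum>s=1..M. omega (p (z @ block_seg \<Xi> j (s + j - 1)))) - \<delta>\<bar>)"

definition d_block :: "nat \<Rightarrow> (nat list \<Rightarrow> real) \<Rightarrow> nat list \<Rightarrow> real" where
  "d_block K p \<Xi> = (THE \<delta>. \<forall>\<epsilon>>0. \<exists>M0>0. \<forall>M\<ge>M0. sup_dev K p \<Xi> \<delta> M \<le> \<epsilon>)"

definition M_block :: "nat \<Rightarrow> (nat list \<Rightarrow> real) \<Rightarrow> nat list \<Rightarrow> real \<Rightarrow> nat" where
  "M_block K p \<Xi> \<epsilon> = (LEAST M0. M0 > 0 \<and> (\<forall>M\<ge>M0. sup_dev K p \<Xi> (d_block K p \<Xi>) M \<le> \<epsilon>))"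

definition lambda_tilde :: "nat \<Rightarrow> (nat list \<Rightarrow> real) \<Rightarrow> nat list \<Rightarrow> ereal" where
  "lambda_tilde K p \<Xi> =
     (SUP z \<in> lists {1..K}. 1 + (\<Sum>t. ereal (\<Prod>s=1..Suc t. 1 - p (z @ block_seg \<Xi> 1 s))))"

definition zeta :: "nat \<Rightarrow> (nat list \<Rightarrow> real) \<Rightarrow> nat list \<Rightarrow> real" where
  "zeta K p \<Xi> =
     (INF (z, j) \<in> lists {1..K} \<times> {1..length \<Xi>}.
        MAX s \<in> {1..2 * length \<Xi>}. p (z @ block_seg \<Xi> j (j + s - 1)))"

definition lambda_seq :: "(nat list \<Rightarrow> real) \<Rightarrow> nat list \<Rightarrow> nat list \<Rightarrow> ereal" where
  "lambda_seq p z0 \<Xi> =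
     (let t0 = length z0 in
      ereal (1 - p []) *
      (1 + ereal (\<Sum>t=1..t0. \<Prod>s=1..t. 1 - p (take s z0))
         + (\<Sum>n. let t = t0 + 1 + n in
              ereal ((\<Prod>s=1..t0. 1 - p (take s z0)) *
                     (\<Prod>s=t0+1..t. 1 - p (z0 @ block_seg \<Xi> 1 (s - t0)))))))"

subsection \<open>Sequences generated by a stationary policy\<close>

definition policy_state :: "(nat list \<Rightarrow> nat) \<Rightarrow> nat list \<Rightarrow> nat \<Rightarrow> nat list" where
  "policy_state \<upsilon> S0 t = ((\<lambda>S. Phi (\<upsilon> S) S) ^^ t) S0"

definition policy_action :: "(nat list \<Rightarrow> nat) \<Rightarrow> nat list \<Rightarrow> nat \<Rightarrow> nat" where
  "policy_action \<upsilon> S0 t = \<upsilon> (policy_state \<upsilon> S0 (t - 1))"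

definition return_time :: "(nat list \<Rightarrow> nat) \<Rightarrow> nat list \<Rightarrow> nat" where
  "return_time \<upsilon> S0 =
     (LEAST t. t \<ge> 1 \<and> (\<exists>l<t. policy_state \<upsilon> S0 t = policy_state \<upsilon> S0 l))"

definition entry_time :: "(nat list \<Rightarrow> nat) \<Rightarrow> nat list \<Rightarrow> nat" where
  "entry_time \<upsilon> S0 =
     (THE l. l < return_time \<upsilon> S0 \<and>
        policy_state \<upsilon> S0 l = policy_state \<upsilon> S0 (return_time \<upsilon> S0))"

definition policy_prefix :: "(nat list \<Rightarrow> nat) \<Rightarrow> nat list \<Rightarrow> nat list" where
  "policy_prefix \<upsilon> S0 = map (policy_action \<upsilon> S0) [1..<entry_time \<upsilon> S0 + 1]"

definition policy_cycle :: "(nat list \<Rightarrow> nat) \<Rightarrow> nat list \<Rightarrow> nat list" where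
  "policy_cycle \<upsilon> S0 = map (policy_action \<upsilon> S0) [entry_time \<upsilon> S0 + 1..<return_time \<upsilon> S0 + 1]"

subsection \<open>Optimal choices\<close>

definition V_opt :: "nat \<Rightarrow> (nat \<Rightarrow> nat list \<Rightarrow> real) \<Rightarrow> nat list \<Rightarrow> ereal" where
  "V_opt K \<Psi> S =
     (INF x \<in> {x :: nat \<Rightarrow> nat. \<forall>t\<ge>1. x t \<in> {1..K}}.
        \<Sum>t. ereal (\<Prod>s=1..Suc t. 1 - \<Psi> (x s) (fold Phi (map x [1..<s]) S)))"

definition optimal_first ::
  "nat \<Rightarrow> nat \<Rightarrow> (nat \<Rightarrow> nat list \<Rightarrow> real) \<Rightarrow> nat list \<Rightarrow> nat list \<Rightarrow> nat list \<Rightarrow> bool" where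
  "optimal_first K \<kappa> \<Psi> S0 z \<Xi> \<longleftrightarrow>
     (\<exists>\<upsilon>. (\<forall>S\<in>words K \<kappa>.
             is_arg_min (\<lambda>x. ereal (1 - \<Psi> x S) * (1 + V_opt K \<Psi> (Phi x S))) (\<lambda>x. x \<in> {1..K}) (\<upsilon> S))
        \<and> z = policy_prefix \<upsilon> S0 \<and> \<Xi> = policy_cycle \<upsilon> S0)"

definition KL_div :: "'b measure \<Rightarrow> ('b \<Rightarrow> real) \<Rightarrow> ('b \<Rightarrow> real) \<Rightarrow> real" where
  "KL_div \<mu> g f = (\<integral>y. ln (g y / f y) * g y \<partial>\<mu>)"

definition prob_density :: "'b measure \<Rightarrow> ('b \<Rightarrow> real) \<Rightarrow> bool" where
  "prob_density \<mu> f \<longleftrightarrow>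
     f \<in> borel_measurable \<mu> \<and> (\<forall>y\<in>space \<mu>. 0 \<le> f y) \<and> (\<integral>\<^sup>+ y. ennreal (f y) \<partial>\<mu>) = 1"

text \<open>Finiteness of the divergence means that the integrand is integrable and that \<open>f x\<close> vanishes
  (almost everywhere) only where \<open>g x\<close> does; the latter is explicit because \<open>ln (a / 0) = 0\<close>.\<close>

definition response_densities ::
  "nat \<Rightarrow> 'b measure \<Rightarrow> (nat \<Rightarrow> 'b \<Rightarrow> real) \<Rightarrow> (nat \<Rightarrow> 'b \<Rightarrow> real) \<Rightarrow> bool" where
  "response_densities K \<mu> f g \<longleftrightarrow>
     sigma_finite_measure \<mu> \<and>
     (\<forall>x\<in>{1..K}. prob_density \<mu> (f x) \<and> prob_density \<mu> (g x)
        \<and> (AE y in \<mu>. g x y > 0 \<longrightarrow> f x y > 0)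
        \<and> integrable \<mu> (\<lambda>y. ln (g x y / f x y) * g x y)
        \<and> KL_div \<mu> (g x) (f x) > 0)"

definition optimal_second ::
  "nat \<Rightarrow> nat \<Rightarrow> (nat \<Rightarrow> nat list \<Rightarrow> real) \<Rightarrow> nat list \<Rightarrow> (nat \<Rightarrow> real) \<Rightarrow> nat list \<Rightarrow> bool" where
  "optimal_second K \<kappa> \<Psi> S0 I \<Xi> \<longleftrightarrow>
     (\<exists>(l' :: real) h' \<upsilon>.
        let Q = (\<lambda>S x. I x + omega (\<Psi> x S) + h' (Phi x S)) in
          (\<forall>S\<in>words K \<kappa>. l' + h' S = (MAX x \<in> {1..K}. Q S x))
        \<and> (\<forall>S\<in>words K \<kappa>. is_arg_max (Q S) (\<lambda>x. x \<in> {1..K}) (\<upsilon> S))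
        \<and> \<Xi> = policy_cycle \<upsilon> S0)"

subsection \<open>Extended logarithm and asymptotics\<close>

definition eln :: "ereal \<Rightarrow> ereal" where
  "eln x = (if x \<le> 0 then -\<infinity> else if x = \<infinity> then \<infinity> else ereal (ln (real_of_ereal x)))"

text \<open>Extended-real version of \<open>f \<in> o[F](g)\<close>: wherever \<open>g\<close> is finite, \<open>f\<close> must be finite as
  well, and wherever \<open>g\<close> is infinite there is no requirement.\<close>

definition esmallo :: "'a filter \<Rightarrow> ('a \<Rightarrow> ereal) \<Rightarrow> ('a \<Rightarrow> ereal) \<Rightarrow> bool" where
  "esmallo F f g \<longleftrightarrow> (\<forall>c>0. \<forall>\<^sub>F x in F. \<bar>f x\<bar> \<le> ereal c * \<bar>g x\<bar>)"

end

theory Submission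
  imports Defs
begin

text \<open>
  Once \<open>\<kappa>\<close> treatments of a block have been applied, the change probabilities form a periodic
  sequence that does not depend on the past; let \<open>q\<close> be its maximum. The period average is
  \<open>d(\<Xi>)\<close>, and averages over \<open>M\<close> steps deviate from it by \<open>O(1 / M)\<close> uniformly in \<open>\<alpha>\<close>. Since
  \<open>2 \<ell> \<ge> \<kappa> + \<ell>\<close>, the window in \<open>\<zeta>(\<Xi>)\<close> sees a full period, so \<open>\<zeta>(\<Xi>) \<ge> q\<close>. Comparison with
  geometric series bounds \<open>\<lambda>~(\<Xi>)\<close> by a constant times \<open>1 / q\<close> from above and \<open>\<lambda>(z\<^sub>0, \<Xi>)\<close> by a
  constant times \<open>1 / q\<close> from below (both are infinite for \<open>q = 0\<close>), and logarithms of \<open>1 / q\<close>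
  are negligible compared with \<open>1 / q + |log \<alpha>|\<close>.
\<close>

section \<open>Images and sums of periodic sequences over windows\<close>

lemma periodic_image_window:
  fixes f :: "nat \<Rightarrow> 'a"
  assumes "\<And>n. f (n + l) = f n"
  shows "f ` {m..<m + l} = f ` {..<l}"
proof (cases "l = 0")
  case False
  show ?thesis
  proof (induction m)
    case 0
    show ?case by (simp add: lessThan_atLeast0)
  next
    case (Suc m)
    \<comment> \<open>Shifting the window by one step drops \<open>m\<close> and adds
      \<open>m + l\<close>, two indices with the same value.\<close>
    have "{Suc m..<Suc m + l} = insert (m + l) {Suc m..<m + l}" "{m..<m + l} = insert m {Suc m..<m + l}"
      using False by auto
    then show ?case using Suc assms[of m] by simp
  qed
qed simp

lemma periodic_sum_window:
  fixes f :: "nat \<Rightarrow> real"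
  assumes "\<And>n. f (n + l) = f n"
  shows "(\<Sum>i<l. f (m + i)) = (\<Sum>i<l. f i)"
proof (induction m)
  case (Suc m)
  have "(\<Sum>i<l. f (Suc m + i)) + f m = (\<Sum>i<Suc l. f (m + i))"
    by (subst sum.lessThan_Suc_shift) simp
  also have "\<dots> = (\<Sum>i<l. f (m + i)) + f m"
    using assms[of m] by simp
  finally show ?case using Suc by simp
qed simp

text \<open>Strong induction peels off full periods, each contributing exactly \<open>l\<close>
  times the mean. In the remainder, shorter than \<open>l\<close>, the sum and its target both lie
  between 0 and \<open>l * B\<close>.\<close>

lemma periodic_sum_deviation:
  fixes f :: "nat \<Rightarrow> real"
  assumes per: "\<And>n. f (n + l) = f n" and bnd: "\<And>n. 0 \<le> f n" "\<And>n. f n \<le> B" and l: "l > 0"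
  shows "\<bar>(\<Sum>i<M. f (m + i)) - real M * ((\<Sum>i<l. f i) / l)\<bar> \<le> l * B"
proof (induction M arbitrary: m rule: less_induct)
  case (less M)
  let ?d = "(\<Sum>i<l. f i) / l"
  show ?case
  proof (cases "M < l")
    case True
    have B: "0 \<le> B" using bnd[of 0] by linarith
    have d: "0 \<le> ?d" "?d \<le> B"
      using l sum_bounded_above[of "{..<l}" f B] bnd by (auto simp: sum_nonneg field_simps)
    have "0 \<le> (\<Sum>i<M. f (m + i))" "(\<Sum>i<M. f (m + i)) \<le> M * B"
      using sum_bounded_above[of "{..<M}" "\<lambda>i. f (m + i)" B] bnd by (auto simp: sum_nonneg)
    moreover have "0 \<le> M * ?d" "M * ?d \<le> M * B"
      using d by (auto intro!: mult_left_mono mult_nonneg_nonneg simp del: times_divide_eq_right)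
    moreover have "M * B \<le> l * B"
      using True B by (intro mult_right_mono) auto
    ultimately show ?thesis by linarith
  next
    case False
    then obtain N where N: "M = l + N" using le_Suc_ex[of l M] by auto
    have "(\<Sum>i<M. f (m + i)) = (\<Sum>i<l. f (m + i)) + (\<Sum>i<N. f (m + l + i))"
      unfolding N using sum.atLeastLessThan_concat[of 0 l "l + N" "\<lambda>i. f (m + i)"]
        sum.shift_bounds_nat_ivl[of "\<lambda>i. f (m + i)" 0 l N]
      by (simp add: lessThan_atLeast0 ac_simps)
    moreover have "real M * ?d = (\<Sum>i<l. f i) + real N * ?d"
      unfolding N using l by (simp add: field_simps)
    ultimately show ?thesis
      using less[of N "m + l"] N l periodic_sum_window[of f l m] per by simp
  qed
qed

section \<open>States, model probabilities and cyclic blocks\<close>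

text \<open>The state is a sliding window over the reversed history. In this form forgetting is
  visible: once \<open>xs\<close> is as long as \<open>S\<close>, the \<open>take\<close> cuts
  \<open>S\<close> off.\<close>

lemma fold_Phi: "fold Phi xs S = take (length S) (rev xs @ S)"
proof (induction xs arbitrary: S)
  case (Cons x xs)
  have "length (Phi x S) = length S" by (simp add: Phi_def)
  then have "fold Phi (x # xs) S = take (length S) (rev xs @ Phi x S)"
    using Cons[of "Phi x S"] by simp
  also have "Phi x S = take (length S) (x # S)"
    by (simp add: Phi_def butlast_conv_take)
  finally show ?case
    by (simp add: min_def)
qed simp

lemma fold_Phi_in_words:
  assumes "S \<in> words K \<kappa>" "xs \<in> lists {1..K}"
  shows "fold Phi xs S \<in> words K \<kappa>"
  using assms unfolding fold_Phi words_def
  by (auto dest!: in_set_takeD simp: in_lists_conv_set)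

lemma Phi_in_words:
  assumes "S \<in> words K \<kappa>" "x \<in> {1..K}"
  shows "Phi x S \<in> words K \<kappa>"
  using fold_Phi_in_words[OF assms(1), of "[x]"] assms(2) by simp

lemma fm_prob_bounds:
  assumes "fm_model K \<kappa> \<Psi> \<pi>0 S0" "z \<in> lists {1..K}"
  shows "0 \<le> fm_prob \<Psi> \<pi>0 S0 z" "fm_prob \<Psi> \<pi>0 S0 z < 1"
proof -
  have "fold Phi (butlast z) S0 \<in> words K \<kappa>"
    using assms by (intro fold_Phi_in_words) (auto simp: fm_model_def in_lists_conv_set dest: in_set_butlastD)
  moreover have "z \<noteq> [] \<Longrightarrow> last z \<in> {1..K}"
    using assms last_in_set[of z] by (auto simp: in_lists_conv_set)
  ultimately show "0 \<le> fm_prob \<Psi> \<pi>0 S0 z" "fm_prob \<Psi> \<pi>0 S0 z < 1"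
    using assms(1) by (auto simp: fm_model_def fm_prob_def)
qed

lemma block_at_in: "\<Xi> \<noteq> [] \<Longrightarrow> block_at \<Xi> i \<in> set \<Xi>"
  unfolding block_at_def by (intro nth_mem) (simp add: nat_less_iff)

lemma block_at_periodic: "block_at \<Xi> (i + int (length \<Xi>)) = block_at \<Xi> i"
  unfolding block_at_def using mod_add_self2[of "i - 1" "int (length \<Xi>)"] by (simp add: algebra_simps)

lemma block_seg_eq: "block_seg \<Xi> j (j + i) = map (\<lambda>k. block_at \<Xi> (int (j + k))) [0..<Suc i]"
  unfolding block_seg_def by (rule nth_equalityI) (auto simp del: upt_Suc)

section \<open>One block at a fixed \<alpha>, under the probability bound\<close>

text \<open>The supremum bound is used pointwise. Since \<open>[]\<close> counts as a treatment
  sequence, \<open>prob_le\<close> also covers the prior.\<close>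

locale bounded_fm_block =
  fixes K \<kappa> :: nat and \<Psi> :: "nat \<Rightarrow> nat list \<Rightarrow> real" and \<pi>0 :: real and S0 \<Xi> :: "nat list" and c :: real
  assumes model: "fm_model K \<kappa> \<Psi> \<pi>0 S0"
    and c_pos: "0 < c"
    and prob_le: "\<And>z. z \<in> lists {1..K} \<Longrightarrow> fm_prob \<Psi> \<pi>0 S0 z \<le> 1 - c"
    and block: "\<Xi> \<in> lists {1..K}" "\<Xi> \<noteq> []"
    and len: "\<kappa> \<le> length \<Xi>"
begin

abbreviation p :: "nat list \<Rightarrow> real" where "p \<equiv> fm_prob \<Psi> \<pi>0 S0"

abbreviation l :: nat where "l \<equiv> length \<Xi>"

text \<open>Steps are counted from 0: \<open>i + 1\<close> block treatments, starting at position
  \<open>j\<close>, have followed \<open>z\<close>.\<close>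

definition w :: "nat list \<Rightarrow> nat \<Rightarrow> nat \<Rightarrow> real" where
  "w z j i = p (z @ block_seg \<Xi> j (j + i))"

text \<open>The limiting periodic sequence: the state consists of the \<open>\<kappa>\<close>
  preceding block entries, most recent first. Integer positions let it be read cyclically before the
  start of the block.\<close>

definition q :: "nat \<Rightarrow> real" where
  "q n = \<Psi> (block_at \<Xi> (int n)) (map (\<lambda>k. block_at \<Xi> (int n - 1 - int k)) [0..<\<kappa>])"

definition qmax :: real where "qmax = Max (q ` {..<l})"

definition dval :: real where "dval = (\<Sum>i<l. omega (q i)) / l"

lemma l_pos: "l > 0" using block by simp

lemma seg_in: "z \<in> lists {1..K} \<Longrightarrow> z @ block_seg \<Xi> j (j + i) \<in> lists {1..K}"
  using block block_at_in[OF block(2)] by (auto simp: block_seg_eq in_lists_conv_set)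

lemma w_bounds:
  assumes "z \<in> lists {1..K}"
  shows "0 \<le> w z j i" "w z j i \<le> 1 - c"
  using fm_prob_bounds[OF model seg_in[OF assms]] prob_le[OF seg_in[OF assms]] by (auto simp: w_def)

text \<open>After \<open>\<kappa>\<close> steps inside the block the state no longer remembers \<open>z\<close>.\<close>

lemma w_eq_q:
  assumes "\<kappa> \<le> i"
  shows "w z j i = q (j + i)"
proof -
  let ?h = "\<lambda>k. block_at \<Xi> (int (j + k))"
  have len0: "length S0 = \<kappa>" using model by (simp add: fm_model_def words_def)
  have "fold Phi (z @ map ?h [0..<i]) S0 = take \<kappa> (rev (map ?h [0..<i]))"
    using assms len0 by (simp only: fold_Phi) simp
  also have "\<dots> = map (\<lambda>k. block_at \<Xi> (int (j + i) - 1 - int k)) [0..<\<kappa>]"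
    using assms by (intro nth_equalityI) (auto simp: rev_nth of_nat_diff algebra_simps)
  finally show ?thesis
    by (simp add: w_def q_def fm_prob_def block_seg_eq butlast_append)
qed

lemma q_periodic: "q (n + l) = q n"
proof -
  have "block_at \<Xi> (int (n + l) - 1 - int k) = block_at \<Xi> (int n - 1 - int k)" for k
    using block_at_periodic[of \<Xi> "int n - 1 - int k"] by (simp add: algebra_simps)
  then show ?thesis
    using block_at_periodic[of \<Xi> "int n"] unfolding q_def by simp
qed

text \<open>Shifting \<open>n\<close> by \<open>\<kappa>\<close> full periods leaves
  \<open>q n\<close> unchanged and passes the forgetting time, so \<open>q n\<close> is a
  probability that the model really attains.\<close>

lemma q_bounds: "0 \<le> q n" "q n \<le> 1 - c"
proof -
  have "q (n + k * l) = q n" for k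
  proof (induction k)
    case (Suc k)
    then show ?case using q_periodic[of "n + k * l"] by (simp add: ac_simps)
  qed simp
  from this[of \<kappa>] have "q (n + \<kappa> * l) = q n" .
  moreover have "\<kappa> \<le> n + \<kappa> * l" using l_pos by (cases l) auto
  ultimately have "w [] 0 (n + \<kappa> * l) = q n" using w_eq_q[of "n + \<kappa> * l" "[]" 0] by simp
  then show "0 \<le> q n" "q n \<le> 1 - c" using w_bounds[of "[]" 0 "n + \<kappa> * l"] by auto
qed

lemma c_le_1: "c \<le> 1"
  using q_bounds[of 0] by linarith

text \<open>The offset \<open>m\<close> is free so that the maximum can be located in a window lying
  after the transient.\<close>

lemma qmax_attained: "\<exists>i<l. q (m + i) = qmax"
proof -
  have "qmax \<in> q ` {..<l}" unfolding qmax_def using l_pos by (intro Max_in) auto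
  then have "qmax \<in> q ` {m..<m + l}" using periodic_image_window[of q l m] q_periodic by simp
  then obtain n where "n \<in> {m..<m + l}" "q n = qmax" by auto
  then show ?thesis by (intro exI[of _ "n - m"]) auto
qed

lemma q_le_qmax: "q n \<le> qmax"
proof -
  have "q n \<in> q ` {n..<n + l}" using l_pos by auto
  then have "q n \<in> q ` {..<l}" using periodic_image_window[of q l n] q_periodic by simp
  then show ?thesis unfolding qmax_def by (intro Max_ge) auto
qed

lemma qmax_bounds: "0 \<le> qmax" "qmax \<le> 1 - c"
  using qmax_attained[of 0] q_bounds by metis+

section \<open>The average \<open>d_block\<close> and the waiting time
  \<open>M_block\<close>\<close>

lemma omega_bounds:
  assumes "0 \<le> x" "x \<le> 1 - c"
  shows "0 \<le> omega x" "omega x \<le> - ln c"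
  using assms c_pos by (auto simp: omega_def abs_if)

lemma dval_bounds: "0 \<le> dval" "dval \<le> - ln c"
  using l_pos sum_bounded_above[of "{..<l}" "\<lambda>i. omega (q i)" "- ln c"] omega_bounds q_bounds
  by (auto simp: dval_def sum_nonneg field_simps)

text \<open>The factor 2 collects two errors of at most \<open>l * (- ln c)\<close> each: replacing
  the transient, at most \<open>\<kappa> \<le> l\<close> steps long, by periodic values, and the
  incomplete last period.\<close>

lemma average_deviation:
  assumes z: "z \<in> lists {1..K}" and M: "M > 0"
  shows "\<bar>(1 / real M) * (\<Sum>s=1..M. omega (p (z @ block_seg \<Xi> j (s + j - 1)))) - dval\<bar>
           \<le> 2 * l * (- ln c) / M"
proof -
  let ?B = "- ln c"
  have B: "0 \<le> ?B" using omega_bounds q_bounds[of 0] by fastforce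
  let ?a = "\<lambda>i. omega (w z j i)" and ?b = "\<lambda>i. omega (q (j + i))"
  \<comment> \<open>Both terms lie between 0 and \<open>- ln c\<close>, and from step
    \<open>\<kappa>\<close> on they coincide.\<close>
  have ab: "\<bar>?a i - ?b i\<bar> \<le> (if i < \<kappa> then ?B else 0)" for i
    using omega_bounds[OF w_bounds[OF z, of j i]] omega_bounds[OF q_bounds[of "j + i"]] w_eq_q[of i z j]
    by auto
  have "\<bar>(\<Sum>i<M. ?a i) - (\<Sum>i<M. ?b i)\<bar> \<le> (\<Sum>i<M. \<bar>?a i - ?b i\<bar>)"
    by (simp flip: sum_subtractf)
  also have "\<dots> \<le> (\<Sum>i<M. if i < \<kappa> then ?B else 0)"
    by (intro sum_mono ab)
  also have "\<dots> = card {i. i < M \<and> i < \<kappa>} * ?B"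
    by (simp flip: sum.inter_filter)
  also have "\<dots> \<le> l * ?B"
  proof (intro mult_right_mono B)
    have "card {i. i < M \<and> i < \<kappa>} \<le> card {..<\<kappa>}" by (intro card_mono) auto
    then show "real (card {i. i < M \<and> i < \<kappa>}) \<le> real l" using len by simp
  qed
  finally have 1: "\<bar>(\<Sum>i<M. ?a i) - (\<Sum>i<M. ?b i)\<bar> \<le> l * ?B" .
  have 2: "\<bar>(\<Sum>i<M. ?b i) - M * dval\<bar> \<le> l * ?B"
    unfolding dval_def
    using q_periodic omega_bounds[OF q_bounds] l_pos
    by (intro periodic_sum_deviation) auto
  have "(\<Sum>s=1..M. omega (p (z @ block_seg \<Xi> j (s + j - 1)))) = (\<Sum>i<M. ?a i)"
    by (simp add: sum.atLeast1_atMost_eq w_def add.commute)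
  moreover have "\<bar>(\<Sum>i<M. ?a i) - M * dval\<bar> \<le> 2 * l * ?B" using 1 2 by linarith
  then have "\<bar>(\<Sum>i<M. ?a i) - M * dval\<bar> / M \<le> 2 * l * ?B / M"
    by (intro divide_right_mono) auto
  moreover have "\<bar>(\<Sum>i<M. ?a i) - M * dval\<bar> / M = \<bar>(1 / real M) * (\<Sum>i<M. ?a i) - dval\<bar>"
  proof -
    have "\<bar>(\<Sum>i<M. ?a i) - M * dval\<bar> / M = \<bar>((\<Sum>i<M. ?a i) - M * dval) / M\<bar>" by simp
    also have "((\<Sum>i<M. ?a i) - M * dval) / M = (1 / real M) * (\<Sum>i<M. ?a i) - dval"
      using M by (simp add: field_simps)
    finally show ?thesis .
  qed
  ultimately show ?thesis by simp
qed

lemma sup_dev_dval: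
  assumes "M > 0"
  shows "sup_dev K p \<Xi> dval M \<le> 2 * l * (- ln c) / M"
  unfolding sup_dev_def
proof (rule cSUP_least)
  show "lists {1..K} \<times> {1..l} \<noteq> {}" using l_pos by (auto simp: Suc_le_eq)
qed (use average_deviation[OF _ assms] in auto)

text \<open>Evaluating the supremum at a single path suffices to pin down the limit. A real supremum
  dominates its members only over a bounded set; the deviations from \<delta> and from
  \<open>dval\<close> differ by at most the distance of these two.\<close>

lemma sup_dev_ge:
  assumes "M > 0"
  shows "\<bar>(1 / real M) * (\<Sum>s=1..M. omega (p ([] @ block_seg \<Xi> 1 (s + 1 - 1)))) - \<delta>\<bar> \<le> sup_dev K p \<Xi> \<delta> M"
  unfolding sup_dev_def
proof (rule order_trans[OF _ cSUP_upper])
  show "([], 1) \<in> lists {1..K} \<times> {1..l}" using l_pos by (auto simp: Suc_le_eq)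
  have "\<bar>(1 / real M) * (\<Sum>s=1..M. omega (p (z @ block_seg \<Xi> j (s + j - 1)))) - \<delta>\<bar>
      \<le> 2 * l * (- ln c) / M + \<bar>dval - \<delta>\<bar>" if "z \<in> lists {1..K}" for z j
    using average_deviation[OF that assms, of j] by linarith
  then show "bdd_above ((\<lambda>(z, j). \<bar>(1 / real M) * (\<Sum>s=1..M. omega (p (z @ block_seg \<Xi> j (s + j - 1)))) - \<delta>\<bar>)
      ` (lists {1..K} \<times> {1..l}))"
    by (intro bdd_aboveI) auto
qed simp

lemma sup_dev_dval_le:
  assumes "\<epsilon> > 0" "M > 2 * l * (- ln c) / \<epsilon>" "M > 0"
  shows "sup_dev K p \<Xi> dval M \<le> \<epsilon>"
proof -
  have "2 * l * (- ln c) / M \<le> \<epsilon>" using assms by (simp add: field_simps)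
  then show ?thesis using sup_dev_dval[OF assms(3)] by linarith
qed

lemma d_block_eq: "d_block K p \<Xi> = dval"
  unfolding d_block_def
proof (rule the_equality)
  show "\<forall>\<epsilon>>0. \<exists>M0>0. \<forall>M\<ge>M0. sup_dev K p \<Xi> dval M \<le> \<epsilon>"
  proof (intro allI impI)
    fix \<epsilon> :: real assume "\<epsilon> > 0"
    obtain N :: nat where "2 * l * (- ln c) / \<epsilon> < N" using reals_Archimedean2 by blast
    then have "sup_dev K p \<Xi> dval M \<le> \<epsilon>" if "M \<ge> Suc N" for M
      using that \<open>\<epsilon> > 0\<close> by (intro sup_dev_dval_le) auto
    then show "\<exists>M0>0. \<forall>M\<ge>M0. sup_dev K p \<Xi> dval M \<le> \<epsilon>" by blast
  qed
next
  fix \<delta> assume \<delta>: "\<forall>\<epsilon>>0. \<exists>M0>0. \<forall>M\<ge>M0. sup_dev K p \<Xi> \<delta> M \<le> \<epsilon>"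
  \<comment> \<open>Uniqueness: for one large \<open>M\<close>, the average along the block after
    the empty history is within \<open>\<epsilon> / 2\<close> of both candidates.\<close>
  have "\<bar>\<delta> - dval\<bar> \<le> \<epsilon>" if \<epsilon>: "\<epsilon> > 0" for \<epsilon>
  proof -
    obtain M0 where M0: "\<forall>M\<ge>M0. sup_dev K p \<Xi> \<delta> M \<le> \<epsilon> / 2"
      using \<delta>[rule_format, OF half_gt_zero[OF \<epsilon>]] by blast
    obtain N :: nat where N: "2 * l * (- ln c) / (\<epsilon> / 2) < N" using reals_Archimedean2 by blast
    define M where "M = Suc (max M0 N)"
    have "sup_dev K p \<Xi> dval M \<le> \<epsilon> / 2"
      using N \<epsilon> unfolding M_def by (intro sup_dev_dval_le) auto
    moreover have "M0 \<le> M" "M > 0" by (auto simp: M_def)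
    moreover from this have "sup_dev K p \<Xi> \<delta> M \<le> \<epsilon> / 2" using M0 by blast
    ultimately show ?thesis using sup_dev_ge[of M \<delta>] sup_dev_ge[of M dval] by linarith
  qed
  then show "\<delta> = dval" using field_le_epsilon[of "\<bar>\<delta> - dval\<bar>" 0] by auto
qed

text \<open>\<open>Suc N\<close> is the first integer above the threshold of
  \<open>sup_dev_dval_le\<close>, hence a candidate for the \<open>LEAST\<close>.\<close>

lemma M_block_le:
  assumes "\<epsilon> > 0"
  shows "real (M_block K p \<Xi> \<epsilon>) \<le> 2 * l * (- ln c) / \<epsilon> + 2"
proof -
  define N where "N = nat \<lfloor>2 * l * (- ln c) / \<epsilon>\<rfloor>"
  have x: "0 \<le> 2 * l * (- ln c) / \<epsilon>"
    using assms dval_bounds by (intro divide_nonneg_pos mult_nonneg_nonneg) auto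
  have "M_block K p \<Xi> \<epsilon> \<le> Suc N"
    unfolding M_block_def
  proof (rule Least_le, intro conjI allI impI)
    fix M assume "Suc N \<le> M"
    then show "sup_dev K p \<Xi> (d_block K p \<Xi>) M \<le> \<epsilon>"
      unfolding d_block_eq using assms
      by (intro sup_dev_dval_le) (auto simp: N_def, linarith)
  qed simp
  moreover have "real N \<le> 2 * l * (- ln c) / \<epsilon>" using x unfolding N_def by linarith
  ultimately show ?thesis by linarith
qed

section \<open>The change probability guaranteed within two block lengths\<close>

lemma zeta_bounds: "qmax \<le> zeta K p \<Xi>" "zeta K p \<Xi> \<le> 1 - c"
proof -
  let ?f = "\<lambda>(z, j). MAX s \<in> {1..2 * l}. p (z @ block_seg \<Xi> j (j + s - 1))"
  have ne: "lists {1..K} \<times> {1..l} \<noteq> {}" using l_pos by (auto simp: Suc_le_eq)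
  have ge: "qmax \<le> ?f (z, j)" for z j
  proof -
    \<comment> \<open>The maximum is sought in the first full period after the
      \<open>\<kappa>\<close> forgetting steps. It is reached at
      \<open>s = \<kappa> + i + 1\<close>, which is at most \<open>2 * l\<close> as
      \<open>\<kappa> \<le> l\<close>.\<close>
    obtain i where i: "i < l" "q (j + \<kappa> + i) = qmax" using qmax_attained by blast
    then have "qmax = p (z @ block_seg \<Xi> j (j + (\<kappa> + i + 1) - 1))"
      using w_eq_q[of "\<kappa> + i" z j] by (simp add: w_def ac_simps)
    moreover have "\<kappa> + i + 1 \<in> {1..2 * l}" using i len by auto
    ultimately have "qmax \<in> (\<lambda>s. p (z @ block_seg \<Xi> j (j + s - 1))) ` {1..2 * l}" by (rule image_eqI)
    then show ?thesis by simp
  qed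
  have le: "?f (z, j) \<le> 1 - c" if "z \<in> lists {1..K}" for z j
  proof -
    have "p (z @ block_seg \<Xi> j (j + s - 1)) \<le> 1 - c" if "s \<in> {1..2 * l}" for s
      using w_bounds(2)[OF \<open>z \<in> lists {1..K}\<close>, of j "s - 1"] that by (simp add: w_def)
    then show ?thesis using l_pos by (auto simp: Suc_le_eq)
  qed
  show "qmax \<le> zeta K p \<Xi>"
    unfolding zeta_def using ge by (intro cINF_greatest[OF ne]) auto
  have "zeta K p \<Xi> \<le> ?f ([], 1)"
    unfolding zeta_def
  proof (rule cINF_lower)
    show "bdd_below (?f ` (lists {1..K} \<times> {1..l}))" using ge by (intro bdd_belowI) auto
  qed (use l_pos in \<open>auto simp: Suc_le_eq\<close>)
  then show "zeta K p \<Xi> \<le> 1 - c" using le[of "[]" 1] by simp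
qed

section \<open>Survival products and the upper bound for \<open>lambda_tilde\<close>\<close>

text \<open>The probability of no change during the first \<open>n\<close> block steps after
  \<open>z\<close>, given none before.\<close>

definition surv :: "nat list \<Rightarrow> nat \<Rightarrow> real" where "surv z n = (\<Prod>i<n. 1 - w z 1 i)"

lemma surv_eq: "(\<Prod>s=1..n. 1 - p (z @ block_seg \<Xi> 1 s)) = surv z n"
  by (simp add: prod.atLeast1_atMost_eq surv_def w_def)

lemma surv_bounds:
  assumes "z \<in> lists {1..K}"
  shows "0 \<le> surv z n" "surv z n \<le> 1"
proof -
  have "0 \<le> 1 - w z 1 i \<and> 1 - w z 1 i \<le> 1" for i
    using w_bounds[OF assms, of 1 i] c_pos by auto
  then show "0 \<le> surv z n" "surv z n \<le> 1"
    unfolding surv_def by (auto intro: prod_nonneg prod_le_1)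
qed

lemma surv_add: "surv z (m + n) = surv z m * (\<Prod>i<n. 1 - w z 1 (m + i))"
  by (induction n) (auto simp: surv_def)

text \<open>A full period after the transient contains a step with change probability
  \<open>qmax\<close>; the other factors are at most 1.\<close>

lemma surv_window:
  assumes z: "z \<in> lists {1..K}" and m: "\<kappa> \<le> m"
  shows "surv z (m + l) \<le> (1 - qmax) * surv z m"
proof -
  have f: "0 \<le> 1 - w z 1 i \<and> 1 - w z 1 i \<le> 1" for i
    using w_bounds[OF z, of 1 i] c_pos by auto
  obtain i where i: "i < l" "q (1 + m + i) = qmax" using qmax_attained by blast
  have "(\<Prod>i<l. 1 - w z 1 (m + i)) = (1 - w z 1 (m + i)) * (\<Prod>k\<in>{..<l} - {i}. 1 - w z 1 (m + k))"
    using i by (subst prod.remove[of _ i]) auto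
  also have "\<dots> \<le> (1 - w z 1 (m + i)) * 1"
    using f by (intro mult_left_mono prod_le_1) auto
  also have "w z 1 (m + i) = qmax" using w_eq_q[of "m + i" z 1] i m by simp
  finally have "(\<Prod>i<l. 1 - w z 1 (m + i)) \<le> 1 - qmax" by simp
  then show ?thesis
    unfolding surv_add using surv_bounds[OF z, of m] by (subst mult.commute) (rule mult_right_mono)
qed

text \<open>The free offset \<open>r\<close> lets one bound serve all positions within a
  period.\<close>

lemma surv_geometric:
  assumes z: "z \<in> lists {1..K}"
  shows "surv z (\<kappa> + k * l + r) \<le> (1 - qmax) ^ k"
proof (induction k)
  case 0
  show ?case using surv_bounds[OF z] by simp
next
  case (Suc k)
  have "surv z (\<kappa> + Suc k * l + r) \<le> (1 - qmax) * surv z (\<kappa> + k * l + r)"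
    using surv_window[OF z, of "\<kappa> + k * l + r"] by (simp add: ac_simps)
  also have "\<dots> \<le> (1 - qmax) * (1 - qmax) ^ k"
    using Suc qmax_bounds c_pos by (intro mult_left_mono) auto
  finally show ?case by simp
qed

text \<open>The first \<open>\<kappa>\<close> terms are at most 1 each. The rest is grouped into
  periods, which are dominated by a geometric series of ratio \<open>1 - qmax\<close>.\<close>

lemma surv_sum_le:
  assumes z: "z \<in> lists {1..K}" and q: "qmax > 0"
  shows "(\<Sum>t<n. surv z (Suc t)) \<le> \<kappa> + l / qmax"
proof -
  \<comment> \<open>Padding with nonnegative terms makes the part after the transient a whole number
    of periods.\<close>
  have "(\<Sum>t<n. surv z (Suc t)) \<le> (\<Sum>t<\<kappa> + n * l. surv z (Suc t))"
    using l_pos surv_bounds[OF z] by (intro sum_mono2) (auto intro!: trans_le_add2 simp: Suc_le_eq)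
  also have "\<dots> = (\<Sum>t<\<kappa>. surv z (Suc t)) + (\<Sum>t<n * l. surv z (Suc (\<kappa> + t)))"
    using sum.atLeastLessThan_concat[of 0 \<kappa> "\<kappa> + n * l" "\<lambda>t. surv z (Suc t)"]
      sum.shift_bounds_nat_ivl[of "\<lambda>t. surv z (Suc t)" 0 \<kappa> "n * l"]
    by (simp add: lessThan_atLeast0 ac_simps)
  also have "(\<Sum>t<\<kappa>. surv z (Suc t)) \<le> \<kappa>"
    using sum_bounded_above[of "{..<\<kappa>}" "\<lambda>t. surv z (Suc t)" 1] surv_bounds[OF z] by simp
  also have "(\<Sum>t<n * l. surv z (Suc (\<kappa> + t))) = (\<Sum>k<n. \<Sum>t=k*l..<k*l+l. surv z (Suc (\<kappa> + t)))"
    by (rule sum.nat_group[symmetric])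
  also have "\<dots> \<le> (\<Sum>k<n. l * (1 - qmax) ^ k)"
  proof (rule sum_mono)
    fix k
    have "surv z (Suc (\<kappa> + t)) \<le> (1 - qmax) ^ k" if "t \<in> {k*l..<k*l+l}" for t
      using surv_geometric[OF z, of k "t - k * l + 1"] that by simp
    then show "(\<Sum>t=k*l..<k*l+l. surv z (Suc (\<kappa> + t))) \<le> l * (1 - qmax) ^ k"
      using sum_bounded_above[of "{k*l..<k*l+l}" "\<lambda>t. surv z (Suc (\<kappa> + t))" "(1 - qmax) ^ k"] by simp
  qed
  also have "\<dots> = l * ((1 - (1 - qmax) ^ n) / qmax)"
    using q sum_gp_strict[of "1 - qmax" n] by (simp flip: sum_distrib_left)
  also have "\<dots> \<le> l * (1 / qmax)"
    using q qmax_bounds c_pos by (intro mult_left_mono divide_right_mono) auto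
  finally show ?thesis by simp
qed

lemma lambda_tilde_le:
  assumes q: "qmax > 0"
  shows "lambda_tilde K p \<Xi> \<le> ereal ((1 + \<kappa> + l) / qmax)"
  unfolding lambda_tilde_def
proof (rule SUP_least)
  fix z assume z: "z \<in> lists {1..K}"
  have "(\<Sum>t. ereal (surv z (Suc t))) \<le> ereal (\<kappa> + l / qmax)"
    using surv_sum_le[OF z q] surv_bounds[OF z] by (intro suminf_bound) (auto simp: sum_ereal)
  then have "1 + (\<Sum>t. ereal (surv z (Suc t))) \<le> 1 + ereal (\<kappa> + l / qmax)"
    by (intro add_left_mono)
  also have "\<dots> = ereal (1 + \<kappa> + l / qmax)" by (simp add: one_ereal_def)
  \<comment> \<open>As \<open>qmax \<le> 1\<close>, the constant \<open>1 + \<kappa>\<close> may be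
    divided by \<open>qmax\<close> as well.\<close>
  also have "1 + \<kappa> + l / qmax \<le> (1 + \<kappa>) / qmax + l / qmax"
    using q qmax_bounds c_pos mult_left_mono[of qmax 1 "1 + real \<kappa>"] by (simp add: pos_le_divide_eq)
  also have "\<dots> = (1 + \<kappa> + l) / qmax" by (simp add: add_divide_distrib)
  finally show "1 + (\<Sum>t. ereal (\<Prod>s=1..Suc t. 1 - p (z @ block_seg \<Xi> 1 s))) \<le> ereal ((1 + \<kappa> + l) / qmax)"
    unfolding surv_eq by simp
qed

lemma lambda_tilde_ge: "1 \<le> lambda_tilde K p \<Xi>"
  unfolding lambda_tilde_def
proof (rule SUP_upper2[of "[]"])
  have "0 \<le> (\<Sum>t. ereal (surv [] (Suc t)))"
    using surv_bounds[of "[]"] by (intro suminf_0_le) auto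
  then show "1 \<le> 1 + (\<Sum>t. ereal (\<Prod>s=1..Suc t. 1 - p ([] @ block_seg \<Xi> 1 s)))"
    unfolding surv_eq by (simp add: add_increasing2)
qed simp

section \<open>Lower bounds for \<open>lambda_seq\<close>\<close>

lemma surv_ge:
  assumes z: "z \<in> lists {1..K}"
  shows "c ^ \<kappa> * (1 - qmax) ^ n \<le> surv z n"
proof -
  have q: "0 \<le> 1 - qmax" "1 - qmax \<le> 1" using qmax_bounds c_pos by auto
  \<comment> \<open>Only the first \<open>\<kappa>\<close> factors cost a \<open>c\<close>; the
    exponent \<open>min n \<kappa>\<close> counts those met so far and makes the induction go
    through.\<close>
  have "c ^ (min n \<kappa>) * (1 - qmax) ^ n \<le> surv z n"
  proof (induction n)
    case (Suc n)
    have "(if n < \<kappa> then c else 1) * (1 - qmax) \<le> 1 - w z 1 n"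
    proof (cases "n < \<kappa>")
      case True
      have "c * (1 - qmax) \<le> c * 1" using q c_pos by (intro mult_left_mono) auto
      then show ?thesis using True w_bounds[OF z, of 1 n] by simp
    next
      case False
      then show ?thesis using w_eq_q[of n z 1] q_le_qmax[of "1 + n"] by simp
    qed
    then have "(c ^ (min n \<kappa>) * (1 - qmax) ^ n) * ((if n < \<kappa> then c else 1) * (1 - qmax))
        \<le> surv z n * (1 - w z 1 n)"
      using Suc surv_bounds[OF z] q c_pos by (intro mult_mono) auto
    moreover have "c ^ (min (Suc n) \<kappa>) = c ^ (min n \<kappa>) * (if n < \<kappa> then c else 1)"
      by (auto simp: min_def not_le le_Suc_eq)
    ultimately show ?case by (simp add: surv_def ac_simps)
  qed (simp add: surv_def)
  moreover have "c ^ \<kappa> \<le> c ^ (min n \<kappa>)"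
    using c_pos c_le_1 by (intro power_decreasing) auto
  then have "c ^ \<kappa> * (1 - qmax) ^ n \<le> c ^ (min n \<kappa>) * (1 - qmax) ^ n"
    using q by (intro mult_right_mono) auto
  ultimately show ?thesis by linarith
qed

text \<open>Only the block tail is kept. The exponent of \<open>c\<close> counts one factor for the
  prior, \<open>length z\<close> for the initial sequence, \<open>\<kappa>\<close> for the
  transient, and one traded for a factor \<open>1 - qmax\<close>.\<close>

lemma lambda_seq_ge:
  assumes z: "z \<in> lists {1..K}"
  shows "(\<Sum>n. ereal (c ^ (2 + length z + \<kappa>) * (1 - qmax) ^ n)) \<le> lambda_seq p z \<Xi>"
proof -
  let ?t0 = "length z"
  let ?A = "\<Prod>s=1..?t0. 1 - p (take s z)"
  have take: "take s z \<in> lists {1..K}" for s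
    using z by (auto simp: in_lists_conv_set dest: in_set_takeD)
  have f: "c \<le> 1 - p (take s z)" for s using prob_le[OF take] by (simp add: algebra_simps)
  have A: "c ^ ?t0 \<le> ?A"
    using prod_mono[of "{1..?t0}" "\<lambda>_. c" "\<lambda>s. 1 - p (take s z)"] f c_pos by simp
  have A0: "0 \<le> ?A" using A c_pos by (meson order_trans zero_le_power less_imp_le)
  have p0: "c \<le> 1 - p []" using f[of 0] by simp
  have q: "c \<le> 1 - qmax" using qmax_bounds by auto
  \<comment> \<open>Tail term \<open>n\<close> has outer index \<open>t0 + 1 + n\<close>, so it
    already contains \<open>Suc n\<close> block steps.\<close>
  have shift: "(\<Prod>s=?t0+1..?t0+1+n. 1 - p (z @ block_seg \<Xi> 1 (s - ?t0))) = surv z (Suc n)" for n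
    using prod.shift_bounds_cl_nat_ivl[of "\<lambda>s. 1 - p (z @ block_seg \<Xi> 1 (s - ?t0))" 1 ?t0 "Suc n"]
      surv_eq[of z "Suc n"] by (simp add: ac_simps del: prod.cl_ivl_Suc)
  have summand_le: "c ^ (2 + ?t0 + \<kappa>) * (1 - qmax) ^ n \<le> (1 - p []) * (?A * surv z (Suc n))" for n
  proof -
    have "c ^ \<kappa> * (c * (1 - qmax) ^ n) \<le> c ^ \<kappa> * ((1 - qmax) * (1 - qmax) ^ n)"
      using q c_pos by (intro mult_left_mono mult_right_mono) auto
    also have "\<dots> \<le> surv z (Suc n)" using surv_ge[OF z, of "Suc n"] by simp
    finally have "c * (c ^ ?t0 * (c ^ \<kappa> * (c * (1 - qmax) ^ n))) \<le> (1 - p []) * (?A * surv z (Suc n))"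
      using p0 A A0 c_pos q by (intro mult_mono) auto
    then show ?thesis by (simp add: power_add power2_eq_square ac_simps)
  qed
  have nn: "0 \<le> ereal (?A * surv z (Suc n))" for n
    using A0 surv_bounds[OF z, of "Suc n"] by simp
  have "(\<Sum>n. ereal (c ^ (2 + ?t0 + \<kappa>) * (1 - qmax) ^ n))
      \<le> (\<Sum>n. ereal (1 - p []) * ereal (?A * surv z (Suc n)))"
    using summand_le c_pos q by (intro suminf_le_pos) auto
  also have "\<dots> = ereal (1 - p []) * (\<Sum>n. ereal (?A * surv z (Suc n)))"
    using p0 c_pos nn by (intro suminf_cmult_ereal) auto
  also have "\<dots> \<le> ereal (1 - p []) *
      (1 + ereal (\<Sum>t=1..?t0. \<Prod>s=1..t. 1 - p (take s z)) + (\<Sum>n. ereal (?A * surv z (Suc n))))"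
  proof (intro ereal_mult_left_mono)
    have "0 \<le> (\<Sum>t=1..?t0. \<Prod>s=1..t. 1 - p (take s z))"
      by (intro sum_nonneg prod_nonneg order_trans[OF less_imp_le[OF c_pos] f])
    then have "0 \<le> 1 + ereal (\<Sum>t=1..?t0. \<Prod>s=1..t. 1 - p (take s z))"
      by (simp add: one_ereal_def)
    then show "(\<Sum>n. ereal (?A * surv z (Suc n)))
      \<le> 1 + ereal (\<Sum>t=1..?t0. \<Prod>s=1..t. 1 - p (take s z)) + (\<Sum>n. ereal (?A * surv z (Suc n)))"
      by (rule add_increasing) simp
  qed (use p0 c_pos in auto)
  also have "\<dots> = lambda_seq p z \<Xi>"
    unfolding lambda_seq_def Let_def shift by simp
  finally show ?thesis .
qed

text \<open>The comparison series becomes constant and positive, so its partial sums exceed every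
  real bound.\<close>

lemma lambda_seq_infinite:
  assumes "z \<in> lists {1..K}" "qmax = 0"
  shows "lambda_seq p z \<Xi> = \<infinity>"
proof -
  let ?C = "c ^ (2 + length z + \<kappa>)"
  have C: "0 < ?C" using c_pos by simp
  have "ereal B \<le> lambda_seq p z \<Xi>" for B
  proof -
    obtain n :: nat where n: "B / ?C < n" using reals_Archimedean2 by blast
    then have "ereal B \<le> ereal (n * ?C)" using C by (simp add: field_simps)
    also have "\<dots> = (\<Sum>i<n. ereal ?C)" by (simp add: sum_ereal)
    also have "\<dots> \<le> (\<Sum>i. ereal ?C)" using C by (intro suminf_upper) auto
    also have "\<dots> \<le> lambda_seq p z \<Xi>" using lambda_seq_ge[OF assms(1)] assms(2) by simp
    finally show ?thesis .
  qed
  then show ?thesis by (rule ereal_top)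
qed

lemma lambda_seq_ge_inverse:
  assumes "z \<in> lists {1..K}" "qmax > 0"
  shows "ereal (c ^ (2 + length z + \<kappa>) / qmax) \<le> lambda_seq p z \<Xi>"
proof -
  have "(\<lambda>n. (1 - qmax) ^ n) sums (1 / (1 - (1 - qmax)))"
    using assms(2) qmax_bounds c_pos by (intro geometric_sums) auto
  from sums_mult[OF this, of "c ^ (2 + length z + \<kappa>)"]
  have "(\<lambda>n. ereal (c ^ (2 + length z + \<kappa>) * (1 - qmax) ^ n)) sums ereal (c ^ (2 + length z + \<kappa>) / qmax)"
    unfolding sums_ereal by simp
  then show ?thesis using lambda_seq_ge[OF assms(1)] by (simp add: sums_iff)
qed

text \<open>The constant comes from \<open>ln x \<le> y x - 1 - ln y\<close> with \<open>x = 1 / qmax\<close> and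
  \<open>y = e c\<^bsup>2 + L + \<kappa>\<^esup> / 2\<close>.\<close>

lemma log_terms_le:
  assumes z: "z \<in> lists {1..K}" and L: "length z \<le> L" "l \<le> L" and e: "e > 0"
  shows "\<bar>\<bar>eln (ereal (zeta K p \<Xi>))\<bar> + eln (lambda_tilde K p \<Xi>)\<bar>
    \<le> ereal e * lambda_seq p z \<Xi> + ereal (ln (1 + \<kappa> + L) - 2 - 2 * ln (e * c ^ (2 + L + \<kappa>) / 2))"
proof (cases "qmax = 0")
  case True
  \<comment> \<open>The right-hand side is infinite.\<close>
  then show ?thesis using lambda_seq_infinite[OF z] e by simp
next
  case False
  then have q: "qmax > 0" using qmax_bounds by simp
  define \<Lambda> where "\<Lambda> = real_of_ereal (lambda_tilde K p \<Xi>)"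
  have \<Lambda>: "lambda_tilde K p \<Xi> = ereal \<Lambda>"
    using lambda_tilde_le[OF q] lambda_tilde_ge unfolding \<Lambda>_def
    by (cases "lambda_tilde K p \<Xi>") auto
  have \<Lambda>b: "1 \<le> \<Lambda>" "\<Lambda> \<le> (1 + \<kappa> + l) / qmax"
    using lambda_tilde_le[OF q] lambda_tilde_ge unfolding \<Lambda> by (auto simp: one_ereal_def)
  have \<zeta>: "qmax \<le> zeta K p \<Xi>" "zeta K p \<Xi> < 1" using zeta_bounds c_pos by auto
  let ?C = "c ^ (2 + L + \<kappa>)" and ?y = "e * c ^ (2 + L + \<kappa>) / 2"
  have y: "0 < ?y" using e c_pos by simp
  have "\<bar>\<bar>eln (ereal (zeta K p \<Xi>))\<bar> + eln (lambda_tilde K p \<Xi>)\<bar> = ereal (\<bar>ln (zeta K p \<Xi>)\<bar> + ln \<Lambda>)"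
    using \<zeta> \<Lambda>b q by (simp add: \<Lambda> eln_def)
  also have "\<dots> \<le> ereal (e * (?C / qmax) + (ln (1 + \<kappa> + L) - 2 - 2 * ln ?y))"
  proof -
    \<comment> \<open>\<open>zeta\<close> and \<open>lambda_tilde\<close> contribute one
      \<open>- ln qmax\<close> each. Each is absorbed by half of \<open>e * ?C / qmax\<close>,
      whence the division by 2 in \<open>?y\<close>.\<close>
    have "\<bar>ln (zeta K p \<Xi>)\<bar> \<le> - ln qmax"
      using \<zeta> q by (simp add: abs_if)
    moreover have "ln \<Lambda> \<le> ln ((1 + \<kappa> + L) / qmax)"
    proof (rule ln_mono)
      show "\<Lambda> \<le> (1 + \<kappa> + L) / qmax"
        using \<Lambda>b(2) q L by (elim order_trans) (auto intro!: divide_right_mono)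
    qed (use \<Lambda>b q in auto)
    moreover have "ln ((1 + \<kappa> + L) / qmax) = ln (1 + \<kappa> + L) - ln qmax"
      using q by (intro ln_divide_pos) auto
    moreover have "ln (?y / qmax) \<le> ?y / qmax - 1"
      using y q by (intro ln_le_minus_one) auto
    moreover have "ln (?y / qmax) = ln ?y - ln qmax"
      using y q by (intro ln_divide_pos) auto
    moreover have "2 * (?y / qmax) = e * (?C / qmax)" by simp
    ultimately show ?thesis unfolding ereal_less_eq by linarith
  qed
  also have "\<dots> = ereal e * ereal (?C / qmax) + ereal (ln (1 + \<kappa> + L) - 2 - 2 * ln ?y)" by simp
  also have "\<dots> \<le> ereal e * lambda_seq p z \<Xi> + ereal (ln (1 + \<kappa> + L) - 2 - 2 * ln ?y)"
  proof (intro add_right_mono ereal_mult_left_mono)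
    \<comment> \<open>Passing from \<open>length z\<close> to \<open>L\<close> makes the additive
      constant uniform in \<alpha>.\<close>
    have "?C \<le> c ^ (2 + length z + \<kappa>)"
      using c_pos c_le_1 L by (intro power_decreasing) auto
    then have "ereal (?C / qmax) \<le> ereal (c ^ (2 + length z + \<kappa>) / qmax)"
      using q by (simp add: divide_right_mono)
    then show "ereal (?C / qmax) \<le> lambda_seq p z \<Xi>"
      using lambda_seq_ge_inverse[OF z q] by (rule order_trans)
  qed (use e in simp)
  finally show ?thesis .
qed

lemma lambda_seq_nonneg:
  assumes "z \<in> lists {1..K}"
  shows "0 \<le> lambda_seq p z \<Xi>"
proof -
  have "0 \<le> (\<Sum>n. ereal (c ^ (2 + length z + \<kappa>) * (1 - qmax) ^ n))"
    using c_pos qmax_bounds by (intro suminf_0_le) auto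
  then show ?thesis using lambda_seq_ge[OF assms] by (rule order_trans)
qed

end

section \<open>Return times of stationary policies\<close>

lemma finite_card_words: "finite (words K n)" "card (words K n) = K ^ n"
proof -
  have "words K n = {xs. set xs \<subseteq> {1..K} \<and> length xs = n}"
    by (auto simp: words_def in_lists_conv_set)
  then show "finite (words K n)" "card (words K n) = K ^ n"
    using finite_lists_length_eq[of "{1..K}" n] card_lists_length_eq[of "{1..K}" n] by auto
qed

text \<open>Pigeonhole: the \<open>K ^ \<kappa> + 1\<close> times up to \<open>K ^ \<kappa>\<close>
  meet at most \<open>K ^ \<kappa>\<close> states. Minimality of the return time makes the earlier
  visit unique, so the \<open>THE\<close> in \<open>entry_time\<close> is well defined.\<close>

lemma policy_times:
  assumes S0: "S0 \<in> words K \<kappa>" and \<upsilon>: "\<And>S. S \<in> words K \<kappa> \<Longrightarrow> \<upsilon> S \<in> {1..K}"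
  shows "return_time \<upsilon> S0 \<le> K ^ \<kappa>" "entry_time \<upsilon> S0 < return_time \<upsilon> S0"
proof -
  let ?s = "policy_state \<upsilon> S0"
  let ?P = "\<lambda>t. t \<ge> 1 \<and> (\<exists>l<t. ?s t = ?s l)"
  have s: "?s t \<in> words K \<kappa>" for t
    by (induction t) (use S0 \<upsilon> Phi_in_words in \<open>auto simp: policy_state_def\<close>)
  have "\<not> inj_on ?s {..K ^ \<kappa>}"
  proof
    assume "inj_on ?s {..K ^ \<kappa>}"
    then have "card {..K ^ \<kappa>} \<le> card (words K \<kappa>)"
      using s finite_card_words(1) by (intro card_inj_on_le[of ?s]) auto
    then show False by (simp add: finite_card_words)
  qed
  then obtain a b where ab: "a \<le> K ^ \<kappa>" "b \<le> K ^ \<kappa>" "a \<noteq> b" "?s a = ?s b"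
    by (auto simp: inj_on_def)
  have "\<exists>t\<le>K ^ \<kappa>. ?P t"
  proof (cases "a < b")
    case True
    then show ?thesis using ab by (intro exI[of _ b]) (auto intro!: exI[of _ a])
  next
    case False
    then show ?thesis using ab by (intro exI[of _ a]) (auto intro!: exI[of _ b])
  qed
  then obtain t where t: "t \<le> K ^ \<kappa>" "?P t" by blast
  have u: "?P (return_time \<upsilon> S0)"
    unfolding return_time_def using t(2) by (rule LeastI)
  have least: "return_time \<upsilon> S0 \<le> m" if "?P m" for m
    unfolding return_time_def using that by (rule Least_le)
  show "return_time \<upsilon> S0 \<le> K ^ \<kappa>" using least[OF t(2)] t(1) by simp
  obtain k where k: "k < return_time \<upsilon> S0" "?s k = ?s (return_time \<upsilon> S0)" using u by auto
  have "k' = k" if k': "k' < return_time \<upsilon> S0" "?s k' = ?s (return_time \<upsilon> S0)" for k'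
  proof (rule ccontr)
    assume "k' \<noteq> k"
    then have "k < k' \<or> k' < k" by auto
    \<comment> \<open>The later of two distinct candidates would itself be a repetition before the
      return time.\<close>
    then have "?P k \<or> ?P k'" using k(2) k'(2) by (metis One_nat_def Suc_leI less_nat_zero_code neq0_conv)
    then show False using least[of k] least[of k'] k(1) k'(1) by auto
  qed
  then have "entry_time \<upsilon> S0 = k"
    unfolding entry_time_def using k by (intro the_equality conjI) blast+
  then show "entry_time \<upsilon> S0 < return_time \<upsilon> S0" using k by simp
qed

lemma policy_lengths:
  assumes "S0 \<in> words K \<kappa>" "\<And>S. S \<in> words K \<kappa> \<Longrightarrow> \<upsilon> S \<in> {1..K}"
  shows "length (policy_prefix \<upsilon> S0) \<le> K ^ \<kappa>" "length (policy_cycle \<upsilon> S0) \<le> K ^ \<kappa>"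
  using policy_times[of S0 K \<kappa> \<upsilon>] assms by (auto simp: policy_prefix_def policy_cycle_def)

section \<open>Asymptotics as \<alpha> tends to 0\<close>

lemma bounded_smallo_abs_ln:
  fixes f :: "real \<Rightarrow> real"
  assumes "\<forall>\<^sub>F \<alpha> in at_right 0. \<bar>f \<alpha>\<bar> \<le> C"
  shows "f \<in> o[at_right 0](\<lambda>\<alpha>. \<bar>ln \<alpha>\<bar>)"
proof -
  have "f \<in> O[at_right 0](\<lambda>_. 1)" using assms by (intro bigoI[of _ C]) auto
  moreover have "(\<lambda>_. 1 :: real) \<in> o[at_right 0](\<lambda>\<alpha>. \<bar>ln \<alpha>\<bar>)"
  proof (rule landau_o.smallI)
    fix e :: real assume e: "e > 0"
    have "\<forall>\<^sub>F \<alpha> in at_right (0::real). ln \<alpha> \<le> - (1 / e)"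
      using ln_at_0 by (simp add: filterlim_at_bot)
    then show "\<forall>\<^sub>F \<alpha> in at_right 0. norm (1::real) \<le> e * norm \<bar>ln (\<alpha>::real)\<bar>"
    proof eventually_elim
      case (elim \<alpha>)
      have "1 / e \<le> \<bar>ln \<alpha>\<bar>" using elim by linarith
      then show ?case using e by (simp add: field_simps)
    qed
  qed
  ultimately show ?thesis by (rule landau_o.big_small_trans)
qed

theorem lemma6p1:
  fixes K \<kappa> :: nat
    and \<Psi> :: "real \<Rightarrow> nat \<Rightarrow> nat list \<Rightarrow> real"
    and \<pi>0 :: "real \<Rightarrow> real"
    and S0 :: "nat list"
    and z0 \<Xi>1 \<Xi>2 :: "real \<Rightarrow> nat list"
    and \<mu> :: "'b measure"
    and f g :: "nat \<Rightarrow> 'b \<Rightarrow> real"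
  assumes K: "K \<ge> 2"
    and model: "\<And>\<alpha>. \<alpha> \<in> {0<..<1} \<Longrightarrow> fm_model K \<kappa> (\<Psi> \<alpha>) (\<pi>0 \<alpha>) S0"
    and z0: "\<And>\<alpha>. \<alpha> \<in> {0<..<1} \<Longrightarrow> z0 \<alpha> \<in> lists {1..K}"
    and \<Xi>1: "\<And>\<alpha>. \<alpha> \<in> {0<..<1} \<Longrightarrow> \<Xi>1 \<alpha> \<in> lists {1..K} \<and> \<Xi>1 \<alpha> \<noteq> []"
    and \<Xi>2: "\<And>\<alpha>. \<alpha> \<in> {0<..<1} \<Longrightarrow> \<Xi>2 \<alpha> \<in> lists {1..K} \<and> \<Xi>2 \<alpha> \<noteq> []"
    and bound: "\<exists>c\<in>{0<..<1}. \<forall>\<^sub>F \<alpha> in at_right 0.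
                  (SUP z\<in>lists {1..K}. fm_prob (\<Psi> \<alpha>) (\<pi>0 \<alpha>) S0 z) \<le> 1 - c"
    and len_ge: "\<And>\<alpha>. \<alpha> \<in> {0<..<1} \<Longrightarrow> min (length (\<Xi>1 \<alpha>)) (length (\<Xi>2 \<alpha>)) \<ge> \<kappa>"
    and len_bounded: "(\<lambda>\<alpha>. real (max (max (length (\<Xi>1 \<alpha>)) (length (\<Xi>2 \<alpha>))) (length (z0 \<alpha>))))
                        \<in> O[at_right 0](\<lambda>_. 1)"
  shows "(\<lambda>\<alpha>. max (d_block K (fm_prob (\<Psi> \<alpha>) (\<pi>0 \<alpha>) S0) (\<Xi>1 \<alpha>))
                  (d_block K (fm_prob (\<Psi> \<alpha>) (\<pi>0 \<alpha>) S0) (\<Xi>2 \<alpha>)))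
           \<in> O[at_right 0](\<lambda>_. 1)
       \<and> (\<forall>\<epsilon>\<in>{0<..<1}.
           (\<lambda>\<alpha>. real (max (M_block K (fm_prob (\<Psi> \<alpha>) (\<pi>0 \<alpha>) S0) (\<Xi>1 \<alpha>) \<epsilon>)
                           (M_block K (fm_prob (\<Psi> \<alpha>) (\<pi>0 \<alpha>) S0) (\<Xi>2 \<alpha>) \<epsilon>)))
             \<in> o[at_right 0](\<lambda>\<alpha>. \<bar>ln \<alpha>\<bar>))
       \<and> (\<lambda>\<alpha>. real (max (length (\<Xi>1 \<alpha>)) (length (\<Xi>2 \<alpha>)))) \<in> O[at_right 0](\<lambda>\<alpha>. \<bar>ln \<alpha>\<bar>)
       \<and> esmallo (at_right 0)
           (\<lambda>\<alpha>. \<bar>eln (ereal (zeta K (fm_prob (\<Psi> \<alpha>) (\<pi>0 \<alpha>) S0) (\<Xi>1 \<alpha>)))\<bar>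
                + eln (lambda_tilde K (fm_prob (\<Psi> \<alpha>) (\<pi>0 \<alpha>) S0) (\<Xi>1 \<alpha>)))
           (\<lambda>\<alpha>. lambda_seq (fm_prob (\<Psi> \<alpha>) (\<pi>0 \<alpha>) S0) (z0 \<alpha>) (\<Xi>1 \<alpha>) + ereal \<bar>ln \<alpha>\<bar>)
       \<and> (response_densities K \<mu> f g \<longrightarrow>
           (\<forall>\<alpha>\<in>{0<..<1}. \<forall>z X1 X2.
              optimal_first K \<kappa> (\<Psi> \<alpha>) S0 z X1 \<and>
              optimal_second K \<kappa> (\<Psi> \<alpha>) S0 (\<lambda>x. KL_div \<mu> (g x) (f x)) X2 \<longrightarrow>
              length z \<le> K ^ \<kappa> \<and> length X1 \<le> K ^ \<kappa> \<and> length X2 \<le> K ^ \<kappa>))"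
proof -
  let ?p = "\<lambda>\<alpha>. fm_prob (\<Psi> \<alpha>) (\<pi>0 \<alpha>) S0"
  obtain c where c: "0 < c" and cb: "\<forall>\<^sub>F \<alpha> in at_right 0. (SUP z\<in>lists {1..K}. ?p \<alpha> z) \<le> 1 - c"
    using bound by auto
  obtain L0 where L0: "\<forall>\<^sub>F \<alpha> in at_right 0.
      norm (real (max (max (length (\<Xi>1 \<alpha>)) (length (\<Xi>2 \<alpha>))) (length (z0 \<alpha>)))) \<le> L0 * norm (1::real)"
    using len_bounded by (elim landau_o.bigE)
  define L where "L = nat \<lceil>L0\<rceil>"
  \<comment> \<open>\<open>G\<close> collects all that holds for small \<alpha>, with the same
    \<open>c\<close> and \<open>L\<close> for both blocks; every bound below is therefore uniform in
    \<alpha>.\<close>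
  define G where "G \<alpha> \<longleftrightarrow> \<alpha> \<in> {0<..<1} \<and> z0 \<alpha> \<in> lists {1..K} \<and> length (z0 \<alpha>) \<le> L
      \<and> length (\<Xi>1 \<alpha>) \<le> L \<and> length (\<Xi>2 \<alpha>) \<le> L
      \<and> bounded_fm_block K \<kappa> (\<Psi> \<alpha>) (\<pi>0 \<alpha>) S0 (\<Xi>1 \<alpha>) c
      \<and> bounded_fm_block K \<kappa> (\<Psi> \<alpha>) (\<pi>0 \<alpha>) S0 (\<Xi>2 \<alpha>) c" for \<alpha>
  have "\<forall>\<^sub>F \<alpha> in at_right (0::real). \<alpha> \<in> {0<..<1}"
    by (rule eventually_at_right_real) simp
  then have G: "\<forall>\<^sub>F \<alpha> in at_right 0. G \<alpha>"
    using cb L0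
  proof eventually_elim
    case (elim \<alpha>)
    \<comment> \<open>Boundedness is what turns the assumed bound on the real \<open>SUP\<close>
      into a pointwise one.\<close>
    have "bdd_above (?p \<alpha> ` lists {1..K})"
      using fm_prob_bounds(2)[OF model[OF elim(1)]] by (intro bdd_aboveI2[of _ _ 1]) (rule less_imp_le)
    then have "?p \<alpha> z \<le> 1 - c" if "z \<in> lists {1..K}" for z
      using cSUP_upper[OF that] elim(2) by fastforce
    moreover have "length (z0 \<alpha>) \<le> L" "length (\<Xi>1 \<alpha>) \<le> L" "length (\<Xi>2 \<alpha>) \<le> L"
      using elim(3) unfolding L_def by (auto simp: nat_le_real_less ceiling_le_iff) linarith+
    ultimately show ?case
      unfolding G_def bounded_fm_block_def
      using elim(1) model[OF elim(1)] z0[OF elim(1)] \<Xi>1[OF elim(1)] \<Xi>2[OF elim(1)] len_ge[OF elim(1)] c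
      by auto
  qed
  have d: "(\<lambda>\<alpha>. max (d_block K (?p \<alpha>) (\<Xi>1 \<alpha>)) (d_block K (?p \<alpha>) (\<Xi>2 \<alpha>))) \<in> O[at_right 0](\<lambda>_. 1)"
  proof (rule bigoI[of _ "- ln c"])
    show "\<forall>\<^sub>F \<alpha> in at_right 0.
      norm (max (d_block K (?p \<alpha>) (\<Xi>1 \<alpha>)) (d_block K (?p \<alpha>) (\<Xi>2 \<alpha>))) \<le> - ln c * norm (1::real)"
      using G
    proof eventually_elim
      case (elim \<alpha>)
      then show ?case
        unfolding G_def
        using bounded_fm_block.d_block_eq[of K \<kappa> "\<Psi> \<alpha>" "\<pi>0 \<alpha>" S0 _ c]
          bounded_fm_block.dval_bounds[of K \<kappa> "\<Psi> \<alpha>" "\<pi>0 \<alpha>" S0 _ c]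
        by (auto simp: max_def)
    qed
  qed
  have M: "(\<lambda>\<alpha>. real (max (M_block K (?p \<alpha>) (\<Xi>1 \<alpha>) \<epsilon>) (M_block K (?p \<alpha>) (\<Xi>2 \<alpha>) \<epsilon>)))
      \<in> o[at_right 0](\<lambda>\<alpha>. \<bar>ln \<alpha>\<bar>)" if \<epsilon>: "\<epsilon> \<in> {0<..<1}" for \<epsilon>
  proof (rule bounded_smallo_abs_ln[where C = "2 * L * (- ln c) / \<epsilon> + 2"])
    show "\<forall>\<^sub>F \<alpha> in at_right 0. \<bar>real (max (M_block K (?p \<alpha>) (\<Xi>1 \<alpha>) \<epsilon>) (M_block K (?p \<alpha>) (\<Xi>2 \<alpha>) \<epsilon>))\<bar>
        \<le> 2 * L * (- ln c) / \<epsilon> + 2"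
      using G
    proof eventually_elim
      case (elim \<alpha>)
      have "real (M_block K (?p \<alpha>) X \<epsilon>) \<le> 2 * L * (- ln c) / \<epsilon> + 2"
        if X: "bounded_fm_block K \<kappa> (\<Psi> \<alpha>) (\<pi>0 \<alpha>) S0 X c" "length X \<le> L" for X
      proof -
        have "0 \<le> - ln c"
          using bounded_fm_block.c_le_1[OF X(1)] c by simp
        then have "2 * length X * (- ln c) / \<epsilon> \<le> 2 * L * (- ln c) / \<epsilon>"
          using X(2) \<epsilon> by (intro divide_right_mono mult_right_mono) auto
        then show ?thesis using bounded_fm_block.M_block_le[OF X(1), of \<epsilon>] \<epsilon> by simp
      qed
      then show ?case using elim unfolding G_def by (auto simp: max_def)
    qed
  qed
  have len: "(\<lambda>\<alpha>. real (max (length (\<Xi>1 \<alpha>)) (length (\<Xi>2 \<alpha>)))) \<in> O[at_right 0](\<lambda>\<alpha>. \<bar>ln \<alpha>\<bar>)"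
  proof (rule landau_o.small_imp_big, rule bounded_smallo_abs_ln[where C = L])
    show "\<forall>\<^sub>F \<alpha> in at_right 0. \<bar>real (max (length (\<Xi>1 \<alpha>)) (length (\<Xi>2 \<alpha>)))\<bar> \<le> real L"
      using G by eventually_elim (auto simp: G_def)
  qed
  have logs: "esmallo (at_right 0)
      (\<lambda>\<alpha>. \<bar>eln (ereal (zeta K (?p \<alpha>) (\<Xi>1 \<alpha>)))\<bar> + eln (lambda_tilde K (?p \<alpha>) (\<Xi>1 \<alpha>)))
      (\<lambda>\<alpha>. lambda_seq (?p \<alpha>) (z0 \<alpha>) (\<Xi>1 \<alpha>) + ereal \<bar>ln \<alpha>\<bar>)"
    unfolding esmallo_def
  proof (intro allI impI)
    fix e :: real assume e: "e > 0"
    \<comment> \<open>The additive constant of \<open>log_terms_le\<close>. It does not depend on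
      \<alpha>, so \<open>e * \<bar>ln \<alpha>\<bar>\<close> eventually dominates it.\<close>
    define D where "D = ln (1 + \<kappa> + L) - 2 - 2 * ln (e * c ^ (2 + L + \<kappa>) / 2)"
    have "(\<lambda>_. D) \<in> o[at_right 0](\<lambda>\<alpha>. \<bar>ln \<alpha>\<bar>)"
      by (rule bounded_smallo_abs_ln[of _ "\<bar>D\<bar>"]) simp
    then have "\<forall>\<^sub>F \<alpha> in at_right 0. norm D \<le> e * norm \<bar>ln (\<alpha>::real)\<bar>"
      using e by (rule landau_o.smallD)
    with G show "\<forall>\<^sub>F \<alpha> in at_right 0.
      \<bar>\<bar>eln (ereal (zeta K (?p \<alpha>) (\<Xi>1 \<alpha>)))\<bar> + eln (lambda_tilde K (?p \<alpha>) (\<Xi>1 \<alpha>))\<bar>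
        \<le> ereal e * \<bar>lambda_seq (?p \<alpha>) (z0 \<alpha>) (\<Xi>1 \<alpha>) + ereal \<bar>ln \<alpha>\<bar>\<bar>"
    proof eventually_elim
      case (elim \<alpha>)
      then interpret bounded_fm_block K \<kappa> "\<Psi> \<alpha>" "\<pi>0 \<alpha>" S0 "\<Xi>1 \<alpha>" c by (simp add: G_def)
      have z: "z0 \<alpha> \<in> lists {1..K}" and L: "length (z0 \<alpha>) \<le> L" "length (\<Xi>1 \<alpha>) \<le> L"
        using elim(1) by (auto simp: G_def)
      let ?v = "lambda_seq p (z0 \<alpha>) (\<Xi>1 \<alpha>)"
      have "\<bar>\<bar>eln (ereal (zeta K p (\<Xi>1 \<alpha>)))\<bar> + eln (lambda_tilde K p (\<Xi>1 \<alpha>))\<bar> \<le> ereal e * ?v + ereal D"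
        unfolding D_def by (rule log_terms_le[OF z L e])
      also have "\<dots> \<le> ereal e * ?v + ereal (e * \<bar>ln \<alpha>\<bar>)"
        using elim(2) by (intro add_left_mono) simp
      also have "\<dots> = ereal e * (?v + ereal \<bar>ln \<alpha>\<bar>)"
        using lambda_seq_nonneg[OF z] by (subst ereal_right_distrib) auto
      also have "?v + ereal \<bar>ln \<alpha>\<bar> = \<bar>?v + ereal \<bar>ln \<alpha>\<bar>\<bar>"
        using lambda_seq_nonneg[OF z] by simp
      finally show ?case .
    qed
  qed
  have opt: "length z \<le> K ^ \<kappa> \<and> length X1 \<le> K ^ \<kappa> \<and> length X2 \<le> K ^ \<kappa>"
    if \<alpha>: "\<alpha> \<in> {0<..<1}" and first: "optimal_first K \<kappa> (\<Psi> \<alpha>) S0 z X1"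
      and second: "optimal_second K \<kappa> (\<Psi> \<alpha>) S0 (\<lambda>x. KL_div \<mu> (g x) (f x)) X2" for \<alpha> z X1 X2
  proof -
    have S0: "S0 \<in> words K \<kappa>" using model[OF \<alpha>] by (simp add: fm_model_def)
    \<comment> \<open>Feasibility is part of \<open>is_arg_min\<close>; it keeps the visited states
      in \<open>words K \<kappa>\<close>.\<close>
    obtain \<upsilon> where "\<And>S. S \<in> words K \<kappa> \<Longrightarrow> \<upsilon> S \<in> {1..K}" "z = policy_prefix \<upsilon> S0" "X1 = policy_cycle \<upsilon> S0"
      using first unfolding optimal_first_def is_arg_min_def by blast
    moreover obtain \<upsilon>' where "\<And>S. S \<in> words K \<kappa> \<Longrightarrow> \<upsilon>' S \<in> {1..K}" "X2 = policy_cycle \<upsilon>' S0"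
      using second unfolding optimal_second_def is_arg_max_def Let_def by blast
    ultimately show ?thesis
      using policy_lengths[OF S0, of \<upsilon>] policy_lengths[OF S0, of \<upsilon>'] by blast
  qed
  show ?thesis
    using d M len logs opt by blast
qed

end
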